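(* Let $S^k=(I^k,U^k)$ be a finite connected directed network without loops and multiple arcs ($k$ a fixed label), and let $U_T^k\subseteq U^k$ be a spanning tree of $S^k$. Then the set $\{\delta^k(\tau,\rho):(\tau,\rho)^k\in U^k\setminus U_T^k\}$ of characteristic vectors with respect to $U_T^k$ forms a basis of the solution space of the homogeneous linear system $$\sum_{j\in I_i^+(U^k)}x_{ij}^k-\sum_{j\in I_i^-(U^k)}x_{ji}^k=0,\qquad i\in I^k.$$
   Context: Arcs of $U^k$ are written $(i,j)^k$ (directed from $i$ to $j$); connectedness, trees and cycles are understood ignoring orientation. $I_i^+(U^k)=\{j\in I^k:(i,j)^k\in U^k\}$, $I_i^-(U^k)=\{j\in I^k:(j,i)^k\in U^k\}$; the unknowns are $x^k=(x_{ij}^k,(i,j)^k\in U^k)\in\mathbf{R}^{U^k}$. A spanning tree of $S^k$ is a set of arcs of $U^k$ that, ignoring orientation, forms a tree on the whole node set $I^k$. For $(\tau,\rho)^k\in U^k\setminus U_T^k$, $L_{\tau\rho}^k$ denotes the (arc set of the) unique cycle in the network $(I^k,U_T^k\cup\{(\tau,\rho)^k\})$, traversed in the direction given by the arc $(\tau,\rho)^k$. An arc of the cycle is forward if its direction agrees with this traversal direction, and backward if it is opposite. The characteristic vector entailed by $(\tau,\rho)^k$ with respect to $U_T^k$ is $\delta^k(\tau,\rho)=(\delta_{ij}^k(\tau,\rho),(i,j)^k\in U^k)$ with $\delta_{\tau\rho}^k(\tau,\rho)=1$; $\delta_{ij}^k(\tau,\rho)=1$ for forward arcs $(i,j)^k$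 of $L_{\tau\rho}^k$; $\delta_{ij}^k(\tau,\rho)=-1$ for backward arcs $(i,j)^k$ of $L_{\tau\rho}^k$; and $\delta_{ij}^k(\tau,\rho)=0$ for $(i,j)^k\in U^k\setminus L_{\tau\rho}^k$. *)

theory Defs
  imports
    Complex_Main
    "HOL-Library.Function_Algebras"
    "Graph_Theory.Graph_Theory"
begin

text \<open>
  A network is a \<open>pair_pre_digraph\<close>: its arcs are ordered pairs of nodes, so parallel arcs are
  impossible, while an arc and its reverse may both be present.

  The library predicates \<open>forest\<close> and \<open>tree\<close> only exclude \<^emph>\<open>directed\<close> cycles, and on the symmetric
  closure they would count going back and forth along one arc as a cycle. Hence cycles that ignore
  orientation are defined here: they are cycles of the digraph in which every arc \<open>e\<close> can be
  traversed along its direction, \<open>(e, True)\<close>, or against it, \<open>(e, False)\<close>, with the further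
  requirement that no arc is used twice. In particular an arc and its reverse form a cycle of
  length two.
\<close>

definition unoriented :: "'a pair_pre_digraph \<Rightarrow> ('a, ('a \<times> 'a) \<times> bool) pre_digraph" where
  "unoriented G =
     \<lparr> verts = pverts G, arcs = parcs G \<times> UNIV,
       tail = (\<lambda>(e, fwd). if fwd then fst e else snd e),
       head = (\<lambda>(e, fwd). if fwd then snd e else fst e) \<rparr>"

definition unoriented_cycle :: "'a pair_pre_digraph \<Rightarrow> (('a \<times> 'a) \<times> bool) list \<Rightarrow> bool" where
  "unoriented_cycle G p \<longleftrightarrow> pre_digraph.cycle (unoriented G) p \<and> distinct (map fst p)"

definition unoriented_tree :: "'a pair_pre_digraph \<Rightarrow> bool" where
  "unoriented_tree G \<longleftrightarrow>
     Digraph_Component.connected (with_proj G) \<and> \<not> (\<exists>p. unoriented_cycle G p)"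

definition spanning_tree_arcs :: "'a pair_pre_digraph \<Rightarrow> ('a \<times> 'a) set \<Rightarrow> bool" where
  "spanning_tree_arcs S T \<longleftrightarrow> T \<subseteq> parcs S \<and> unoriented_tree (S\<lparr>parcs := T\<rparr>)"

text \<open>
  The cycle closed by \<open>a\<close>, as the list of its arcs in order of traversal, each flagged as forward
  (\<open>True\<close>) or backward (\<open>False\<close>). Starting the list with \<open>(a, True)\<close> fixes the traversal direction
  as that of \<open>a\<close> and removes the ambiguity of the base point.
\<close>

definition fundamental_cycle ::
    "'a pair_pre_digraph \<Rightarrow> ('a \<times> 'a) set \<Rightarrow> 'a \<times> 'a \<Rightarrow> (('a \<times> 'a) \<times> bool) list" where
  "fundamental_cycle S T a =
     (THE p. unoriented_cycle (S\<lparr>parcs := T \<union> {a}\<rparr>) p \<and> hd p = (a, True))"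

definition char_vector ::
    "'a pair_pre_digraph \<Rightarrow> ('a \<times> 'a) set \<Rightarrow> 'a \<times> 'a \<Rightarrow> ('a \<times> 'a \<Rightarrow> real)" where
  "char_vector S T a = (\<lambda>e.
     if e = a then 1
     else if (e, True) \<in> set (fundamental_cycle S T a) then 1
     else if (e, False) \<in> set (fundamental_cycle S T a) then - 1
     else 0)"

definition out_nodes :: "'a pair_pre_digraph \<Rightarrow> 'a \<Rightarrow> 'a set" where
  "out_nodes S i = {j \<in> pverts S. (i, j) \<in> parcs S}"

definition in_nodes :: "'a pair_pre_digraph \<Rightarrow> 'a \<Rightarrow> 'a set" where
  "in_nodes S i = {j \<in> pverts S. (j, i) \<in> parcs S}"

text \<open>
  A vector indexed by the arcs of \<open>S\<close> is a real function on all pairs of nodes that vanishes on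
  the pairs that are not arcs of \<open>S\<close>.
\<close>

definition arc_vectors :: "'a pair_pre_digraph \<Rightarrow> ('a \<times> 'a \<Rightarrow> real) set" where
  "arc_vectors S = {x. \<forall>e. e \<notin> parcs S \<longrightarrow> x e = 0}"

definition solution_space :: "'a pair_pre_digraph \<Rightarrow> ('a \<times> 'a \<Rightarrow> real) set" where
  "solution_space S =
     {x \<in> arc_vectors S.
        \<forall>i \<in> pverts S. (\<Sum>j\<in>out_nodes S i. x (i, j)) - (\<Sum>j\<in>in_nodes S i. x (j, i)) = 0}"

interpretation pair_fun: vector_space "\<lambda>(c::real) (x::'a \<times> 'a \<Rightarrow> real) e. c * x e"
  by unfold_locales (auto simp: fun_eq_iff algebra_simps)

definition basis_of :: "('a \<times> 'a \<Rightarrow> real) set \<Rightarrow> ('a \<times> 'a \<Rightarrow> real) set \<Rightarrow> bool" where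
  "basis_of B V \<longleftrightarrow> pair_fun.independent B \<and> pair_fun.span B = V"

end

theory Submission
  imports Defs
begin

text \<open>
  The net outflow of a walk is concentrated at its two ends, so the signed indicator of a cycle is
  a solution. A solution supported on the tree vanishes: deleting a tree arc \<open>e\<close> separates its ends,
  and the total net outflow of the part containing the head of \<open>e\<close> is minus the value at \<open>e\<close>.
  Both the uniqueness of the fundamental cycles and the spanning property follow from this, since
  the characteristic vectors restrict to the unit vectors outside the tree.
\<close>

section \<open>Unoriented walks\<close>

lemma unoriented_simps [simp]:
  "verts (unoriented G) = pverts G"
  "arcs (unoriented G) = parcs G \<times> UNIV"
  "tail (unoriented G) (e, b) = (if b then fst e else snd e)"
  "head (unoriented G) (e, b) = (if b then snd e else fst e)"
  by (simp_all add: unoriented_def)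

lemma wf_digraph_unoriented:
  assumes "pair_wf_digraph G"
  shows "wf_digraph (unoriented G)"
  using assms by unfold_locales (auto simp: pair_wf_digraph_def)

lemma pair_wf_digraph_sub:
  assumes "pair_wf_digraph S" "A \<subseteq> parcs S"
  shows "pair_wf_digraph (S\<lparr>parcs := A\<rparr>)"
  using assms by (auto simp: pair_wf_digraph_def)

text \<open>Reachability depends only on which ordered pairs of nodes are joined, and these are the
  same for the symmetric closure and for \<open>unoriented G\<close>. This turns connectedness into
  the existence of unoriented walks.\<close>

lemma reachable_unoriented:
  assumes "Digraph_Component.connected (with_proj G)" "u \<in> pverts G" "v \<in> pverts G"
  shows "u \<rightarrow>\<^sup>*\<^bsub>unoriented G\<^esub> v"
proof -
  have "parcs G \<times> UNIV = (\<lambda>e. (e, True)) ` parcs G \<union> (\<lambda>e. (e, False)) ` parcs G"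
    by (auto simp: UNIV_bool)
  then have "parcs (mk_symmetric (with_proj G)) = arcs_ends (unoriented G)"
    by (auto simp: mk_symmetric_def arcs_ends_conv image_Un image_image)
  then show ?thesis
    using assms unfolding connected_def strongly_connected_def reachable_def by simp
qed

lemma arc_end_in_awalk_verts:
  assumes "wf_digraph (unoriented G)" "pre_digraph.awalk (unoriented G) u p v" "e \<in> fst ` set p"
  shows "fst e \<in> set (pre_digraph.awalk_verts (unoriented G) u p)"
    "snd e \<in> set (pre_digraph.awalk_verts (unoriented G) u p)"
proof -
  interpret U: wf_digraph "unoriented G" by fact
  obtain b where b: "(e, b) \<in> set p" using assms(3) by force
  show "fst e \<in> set (U.awalk_verts u p)" "snd e \<in> set (U.awalk_verts u p)"
    using U.awalk_verts_arc1[OF b, of u] U.awalk_verts_arc2[OF assms(2) b]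
    by (auto split: if_splits)
qed

text \<open>Using an arc again, in either direction, would revisit the node just left. Repetition is
  excluded for underlying arcs, not only for flagged ones, as \<open>unoriented_cycle\<close>
  demands.\<close>

lemma apath_distinct_arcs:
  assumes "wf_digraph (unoriented G)" "pre_digraph.apath (unoriented G) u p v"
  shows "distinct (map fst p)"
proof -
  interpret U: wf_digraph "unoriented G" by fact
  from assms(2) show ?thesis
  proof (induction p arbitrary: u)
    case (Cons s p)
    obtain e b where s: "s = (e, b)" by fastforce
    have path: "U.apath (head (unoriented G) s) p v"
      and no: "tail (unoriented G) s \<notin> set (U.awalk_verts (head (unoriented G) s) p)"
      using Cons.prems by (auto simp: U.apath_Cons_iff)
    have "e \<notin> fst ` set p"
      using arc_end_in_awalk_verts[OF assms(1) U.awalkI_apath[OF path], of e] no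
      by (cases b) (auto simp: s)
    then show ?case using Cons.IH[OF path] by (auto simp: s)
  qed simp
qed

text \<open>The first arc of a path is the only one that leaves the initial node.\<close>

lemma apath_eq_if_set_eq:
  assumes "wf_digraph G" "pre_digraph.apath G u p v" "pre_digraph.apath G u q v" "set p = set q"
  shows "p = q"
proof -
  interpret wf_digraph G by fact
  from assms(2-4) show ?thesis
  proof (induction p arbitrary: u q)
    case (Cons s p)
    then obtain t r where q: "q = t # r" by (cases q) auto
    have s: "tail G s = u" "u \<notin> set (awalk_verts (head G s) p)" "apath (head G s) p v"
      and t: "tail G t = u" "u \<notin> set (awalk_verts (head G t) r)" "apath (head G t) r v"
      using Cons.prems by (auto simp: q apath_Cons_iff)
    have "t \<notin> set p" using s t by (metis awalk_verts_arc1)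
    then have st: "s = t" using Cons.prems(3) by (auto simp: q)
    have "distinct (s # p)" "distinct (t # r)"
      using Cons.prems by (auto simp: q apath_def intro: distinct_verts_imp_distinct
          simp del: distinct.simps awalk_verts.simps)
    then have "set p = set r" using Cons.prems(3) st by (auto simp: q)
    then show ?case using Cons.IH s t st by (simp add: q)
  qed simp
qed

text \<open>A path in \<open>A\<close> from the head of \<open>a\<close> back to its tail is closed
  by \<open>a\<close>. With \<open>A\<close> the tree this yields the fundamental cycle; with
  \<open>A\<close> the tree minus \<open>a\<close> it contradicts acyclicity.\<close>

lemma unoriented_cycle_through_arc:
  assumes "pair_wf_digraph S" "A \<subseteq> parcs S" "a \<in> parcs S" "a \<notin> A"
    and "snd a \<rightarrow>\<^sup>*\<^bsub>unoriented (S\<lparr>parcs := A\<rparr>)\<^esub> fst a"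
  shows "\<exists>q. unoriented_cycle (S\<lparr>parcs := A \<union> {a}\<rparr>) ((a, True) # q)"
proof -
  define H where "H = S\<lparr>parcs := A \<union> {a}\<rparr>"
  let ?G = "unoriented (S\<lparr>parcs := A\<rparr>)" and ?H = "unoriented H"
  have H: "pverts H = pverts S" "parcs H = insert a A" by (simp_all add: H_def)
  have wfG: "wf_digraph ?G" and wfH: "wf_digraph ?H"
    unfolding H_def using assms by (auto intro!: wf_digraph_unoriented pair_wf_digraph_sub)
  interpret G: wf_digraph ?G by fact
  interpret H: wf_digraph ?H by fact
  obtain q where q: "G.apath (snd a) q (fst a)"
    using assms(5) G.reachable_apath by blast
  have sub: "subgraph ?G ?H"
    using wfG wfH by (auto simp: subgraph_def compatible_def unoriented_def H)
  have qH: "H.apath (snd a) q (fst a)"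
    using H.subgraph_apath_imp_apath[OF q sub] .
  have "set q \<subseteq> A \<times> UNIV" using q by (auto simp: G.apath_def G.awalk_def)
  then have "distinct (map fst ((a, True) # q))"
    using apath_distinct_arcs[OF wfH qH] assms(4) by auto
  moreover have "H.cycle ((a, True) # q)"
    using qH by (auto simp: H.cycle_def H.apath_def H.awalk_Cons_iff H)
  ultimately show ?thesis unfolding unoriented_cycle_def H_def by blast
qed

text \<open>The leading arc forces the base node to be \<open>fst a\<close>; since the nodes after
  the base are distinct, the remaining arcs form a path.\<close>

lemma unoriented_cycle_ConsE:
  assumes "wf_digraph (unoriented G)" "unoriented_cycle G p" "hd p = (a, True)"
  obtains q where "p = (a, True) # q" "pre_digraph.apath (unoriented G) (snd a) q (fst a)"
    "a \<in> parcs G" "set p \<subseteq> parcs G \<times> UNIV" "distinct (map fst p)"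
proof -
  interpret U: wf_digraph "unoriented G" by fact
  obtain q where p: "p = (a, True) # q"
    using assms by (cases p) (auto simp: unoriented_cycle_def U.cycle_def)
  obtain u where u: "U.awalk u p u" "distinct (tl (U.awalk_verts u p))"
    using assms by (auto simp: unoriented_cycle_def U.cycle_def)
  then have "set p \<subseteq> parcs G \<times> UNIV" by (auto simp: U.awalk_def)
  with u p show ?thesis
    using assms(2) by (intro that[of q]) (auto simp: U.apath_def U.awalk_Cons_iff unoriented_cycle_def)
qed

section \<open>Net outflow\<close>

text \<open>The entries of the node-arc incidence matrix. Summing over all arcs instead of over
  neighbours makes it easy to exchange sums over nodes and arcs.\<close>

definition incidence :: "'a \<Rightarrow> 'a \<times> 'a \<Rightarrow> real" where
  "incidence i e = of_bool (fst e = i) - of_bool (snd e = i)"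

definition net_outflow :: "'a pair_pre_digraph \<Rightarrow> ('a \<times> 'a \<Rightarrow> real) \<Rightarrow> 'a \<Rightarrow> real" where
  "net_outflow S x i = (\<Sum>e\<in>parcs S. x e * incidence i e)"

lemma solution_space_eq:
  assumes "pair_fin_digraph S"
  shows "solution_space S = {x \<in> arc_vectors S. \<forall>i\<in>pverts S. net_outflow S x i = 0}"
proof -
  interpret pair_fin_digraph S by fact
  have fin: "finite (parcs S)" by (rule pair_finite_arcs)
  have "(\<Sum>j\<in>out_nodes S i. x (i, j)) - (\<Sum>j\<in>in_nodes S i. x (j, i)) = net_outflow S x i"
    for x :: "'a \<times> 'a \<Rightarrow> real" and i
  proof -
    have "(\<Sum>j\<in>out_nodes S i. x (i, j)) = (\<Sum>e\<in>{e \<in> parcs S. fst e = i}. x e)"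
      by (rule sum.reindex_bij_witness[of _ snd "Pair i"]) (auto simp: out_nodes_def in_arcsD2)
    also have "\<dots> = (\<Sum>e\<in>parcs S. x e * of_bool (fst e = i))"
      using fin by (simp add: sum.If_cases Int_def of_bool_def if_distrib cong: if_cong)
    finally have o: "(\<Sum>j\<in>out_nodes S i. x (i, j)) = \<dots>" .
    have "(\<Sum>j\<in>in_nodes S i. x (j, i)) = (\<Sum>e\<in>{e \<in> parcs S. snd e = i}. x e)"
      by (rule sum.reindex_bij_witness[of _ fst "\<lambda>j. (j, i)"]) (auto simp: in_nodes_def in_arcsD1)
    also have "\<dots> = (\<Sum>e\<in>parcs S. x e * of_bool (snd e = i))"
      using fin by (simp add: sum.If_cases Int_def of_bool_def if_distrib cong: if_cong)
    finally show ?thesis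
      by (simp add: o net_outflow_def incidence_def right_diff_distrib sum_subtractf)
  qed
  then show ?thesis by (simp add: solution_space_def)
qed

lemma net_outflow_linear:
  "net_outflow S (\<lambda>e. c * x e) i = c * net_outflow S x i"
  "net_outflow S (x + y) i = net_outflow S x i + net_outflow S y i"
  "net_outflow S 0 i = 0"
  by (simp_all add: net_outflow_def sum_distrib_left mult.assoc distrib_right sum.distrib)

lemma subspace_solution_space:
  assumes "pair_fin_digraph S"
  shows "pair_fun.subspace (solution_space S)"
  unfolding pair_fun.subspace_def
  by (auto simp: solution_space_eq[OF assms] arc_vectors_def net_outflow_linear)

text \<open>Applied to differences: two solutions that agree outside \<open>T\<close> are
  equal.\<close>

lemma solution_on_forest_eq_0:
  assumes S: "pair_fin_digraph S" and T: "T \<subseteq> parcs S"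
    and acyclic: "\<not> (\<exists>p. unoriented_cycle (S\<lparr>parcs := T\<rparr>) p)"
    and x: "x \<in> solution_space S" and supp: "\<And>e. e \<notin> T \<Longrightarrow> x e = 0"
  shows "x = 0"
proof
  fix a
  interpret pair_fin_digraph S by fact
  show "x a = 0 a"
  proof (cases "a \<in> T")
    case True
    let ?G = "unoriented (S\<lparr>parcs := T - {a}\<rparr>)"
    have wf: "pair_wf_digraph S" by unfold_locales
    interpret G: wf_digraph ?G
      using T by (intro wf_digraph_unoriented pair_wf_digraph_sub[OF wf]) auto
    \<comment> \<open>The component of the head of \<open>a\<close> after deleting \<open>a\<close>;
      \<open>a\<close> will be the only arc of \<open>T\<close> with exactly one end in
      \<open>C\<close>.\<close>
    define C where "C = {v. snd a \<rightarrow>\<^sup>*\<^bsub>?G\<^esub> v}"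
    have C: "C \<subseteq> pverts S" using G.reachable_in_verts by (auto simp: C_def)
    then have "finite C" using pair_finite_verts finite_subset by blast
    have "snd a \<in> C" using True T by (auto simp: C_def intro!: arc_snd_in_verts)
    have "fst a \<notin> C"
    proof
      assume "fst a \<in> C"
      then have "\<exists>q. unoriented_cycle (S\<lparr>parcs := (T - {a}) \<union> {a}\<rparr>) ((a, True) # q)"
        using True T by (intro unoriented_cycle_through_arc[OF wf]) (auto simp: C_def)
      then show False using acyclic True by (auto simp: insert_absorb)
    qed
    have closed: "fst e \<in> C \<longleftrightarrow> snd e \<in> C" if "e \<in> T" "e \<noteq> a" for e
    proof -
      have "fst e \<rightarrow>\<^bsub>?G\<^esub> snd e" "snd e \<rightarrow>\<^bsub>?G\<^esub> fst e"
        using that by (force simp: arcs_ends_conv image_iff UNIV_bool)+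
      then show ?thesis unfolding C_def by (auto intro: G.reachable_adj_trans)
    qed
    have "0 = (\<Sum>i\<in>C. net_outflow S x i)"
      using x C by (subst sum.neutral) (auto simp: solution_space_eq[OF S])
    also have "\<dots> = (\<Sum>e\<in>parcs S. x e * (\<Sum>i\<in>C. incidence i e))"
      unfolding net_outflow_def by (subst sum.swap) (simp add: sum_distrib_left)
    also have "\<dots> = (\<Sum>e\<in>parcs S. if e = a then - x a else 0)"
    \<comment> \<open>Outside \<open>T\<close> the factor \<open>x e\<close> is zero; an arc of
      \<open>T\<close> other than \<open>a\<close> has both ends or neither in \<open>C\<close>, so
      its incidences cancel. Only \<open>a\<close>, which enters \<open>C\<close>, is left.\<close>
    proof (rule sum.cong)
      fix e
      have "(\<Sum>i\<in>C. incidence i e) = of_bool (fst e \<in> C) - of_bool (snd e \<in> C)"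
        using \<open>finite C\<close> by (simp add: incidence_def sum_subtractf of_bool_def)
      then show "x e * (\<Sum>i\<in>C. incidence i e) = (if e = a then - x a else 0)"
        using closed[of e] supp[of e] \<open>snd a \<in> C\<close> \<open>fst a \<notin> C\<close> by (cases "e \<in> T") auto
    qed simp
    also have "\<dots> = - x a" using True T pair_finite_arcs by auto
    finally show ?thesis by simp
  qed (simp add: supp)
qed

section \<open>The flow along a walk\<close>

text \<open>A signed count of traversals, additive in the list even when arcs repeat, which suits
  induction along a walk.\<close>

definition walk_flow :: "(('a \<times> 'a) \<times> bool) list \<Rightarrow> 'a \<times> 'a \<Rightarrow> real" where
  "walk_flow p e = (\<Sum>(f, b)\<leftarrow>p. if f = e then if b then 1 else - 1 else 0)"

text \<open>Each step adds 1 at its start and -1 at its end, and these telescope. \<open>G\<close>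
  and \<open>S\<close> may differ, since the ends of a flagged arc do not depend on the network; so
  walks in a subnetwork can be balanced in \<open>S\<close>.\<close>

lemma net_outflow_walk_flow:
  assumes "finite (parcs S)" "set p \<subseteq> parcs S \<times> UNIV" "pre_digraph.cas (unoriented G) u p v"
  shows "net_outflow S (walk_flow p) i = of_bool (i = u) - of_bool (i = v)"
  using assms(2,3)
proof (induction p arbitrary: u)
  case Nil
  then show ?case by (simp add: walk_flow_def net_outflow_def pre_digraph.cas.simps)
next
  case (Cons s p)
  obtain e b where s: "s = (e, b)" by fastforce
  define y where "y f = (if f = e then if b then 1 else - 1 else 0 :: real)" for f
  have "net_outflow S y i = (\<Sum>f\<in>parcs S. if f = e then (if b then 1 else - 1) * incidence i e else 0)"
    unfolding net_outflow_def y_def by (rule sum.cong) auto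
  also have "\<dots> = (if b then 1 else - 1) * incidence i e"
    using Cons.prems assms(1) by (simp add: s)
  finally have "net_outflow S y i
      = of_bool (i = tail (unoriented G) s) - of_bool (i = head (unoriented G) s)"
    by (auto simp: s incidence_def)
  moreover have "walk_flow (s # p) = y + walk_flow p"
    by (auto simp: walk_flow_def fun_eq_iff s y_def)
  then have "net_outflow S (walk_flow (s # p)) i = net_outflow S y i + net_outflow S (walk_flow p) i"
    by (simp only: net_outflow_linear)
  ultimately show ?case
    using Cons.IH[of "head (unoriented G) s"] Cons.prems by (simp add: pre_digraph.cas.simps)
qed

text \<open>No arc is repeated, so nothing cancels or accumulates. This links
  \<open>walk_flow\<close> to the case distinction in \<open>char_vector\<close>.\<close>

lemma walk_flow_eq:
  assumes "distinct (map fst p)"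
  shows "walk_flow p e = (if (e, True) \<in> set p then 1 else if (e, False) \<in> set p then - 1 else 0)"
  using assms
proof (induction p)
  case (Cons s p)
  then show ?case
    by (cases s) (force simp: walk_flow_def)
qed (simp add: walk_flow_def)

lemma walk_flow_cycle_in_solution_space:
  assumes "pair_fin_digraph S" "A \<subseteq> parcs S" "unoriented_cycle (S\<lparr>parcs := A\<rparr>) p"
  shows "walk_flow p \<in> solution_space S"
proof -
  interpret pair_fin_digraph S by fact
  obtain u where u: "pre_digraph.cas (unoriented (S\<lparr>parcs := A\<rparr>)) u p u" and p: "set p \<subseteq> A \<times> UNIV"
    using assms(3) by (auto simp: unoriented_cycle_def pre_digraph.cycle_def pre_digraph.awalk_def)
  have "walk_flow p e = 0" if "e \<notin> A" for e
    using assms(3) p that by (subst walk_flow_eq) (auto simp: unoriented_cycle_def)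
  then have "walk_flow p \<in> arc_vectors S"
    using assms(2) unfolding arc_vectors_def by blast
  moreover have "net_outflow S (walk_flow p) i = 0" for i
    using net_outflow_walk_flow[OF pair_finite_arcs _ u] p assms(2) by fastforce
  ultimately show ?thesis by (simp add: solution_space_eq[OF assms(1)])
qed

section \<open>Fundamental cycles\<close>

text \<open>Existence: the tree joins the ends of \<open>a\<close>. Uniqueness: two candidates have
  equal flows, the flow determines the flagged arcs, and a path is determined by its set of
  arcs.\<close>

lemma ex1_fundamental_cycle:
  assumes S: "pair_fin_digraph S" and T: "spanning_tree_arcs S T" and a: "a \<in> parcs S - T"
  shows "\<exists>!p. unoriented_cycle (S\<lparr>parcs := T \<union> {a}\<rparr>) p \<and> hd p = (a, True)"
proof -
  interpret pair_fin_digraph S by fact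
  have wf: "pair_wf_digraph S" by unfold_locales
  define H where "H = S\<lparr>parcs := T \<union> {a}\<rparr>"
  have parcs_H: "parcs H = T \<union> {a}" by (simp add: H_def)
  have sub: "T \<subseteq> parcs S" and conn: "Digraph_Component.connected (with_proj (S\<lparr>parcs := T\<rparr>))"
    and acyclic: "\<not> (\<exists>p. unoriented_cycle (S\<lparr>parcs := T\<rparr>) p)"
    using T by (auto simp: spanning_tree_arcs_def unoriented_tree_def)
  have subH: "T \<union> {a} \<subseteq> parcs S" using sub a by auto
  have wfH: "wf_digraph (unoriented H)"
    unfolding H_def using subH by (intro wf_digraph_unoriented pair_wf_digraph_sub[OF wf])
  have "snd a \<rightarrow>\<^sup>*\<^bsub>unoriented (S\<lparr>parcs := T\<rparr>)\<^esub> fst a"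
    using a by (intro reachable_unoriented[OF conn]) (auto intro: arc_fst_in_verts arc_snd_in_verts)
  then have ex: "\<exists>q. unoriented_cycle H ((a, True) # q)"
    unfolding H_def using a sub by (intro unoriented_cycle_through_arc[OF wf]) auto
  have "p = p'"
    if p: "unoriented_cycle H p" "hd p = (a, True)" and p': "unoriented_cycle H p'" "hd p' = (a, True)"
    for p p'
  proof -
    obtain q where q: "p = (a, True) # q" "pre_digraph.apath (unoriented H) (snd a) q (fst a)"
      "set p \<subseteq> (T \<union> {a}) \<times> UNIV" "distinct (map fst p)"
      using p by (metis unoriented_cycle_ConsE[OF wfH] parcs_H)
    obtain q' where q': "p' = (a, True) # q'" "pre_digraph.apath (unoriented H) (snd a) q' (fst a)"
      "set p' \<subseteq> (T \<union> {a}) \<times> UNIV" "distinct (map fst p')"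
      using p' by (metis unoriented_cycle_ConsE[OF wfH] parcs_H)
    have "walk_flow p - walk_flow p' = 0"
    proof (rule solution_on_forest_eq_0[OF S sub acyclic])
      show "walk_flow p - walk_flow p' \<in> solution_space S"
        using pair_fun.subspace_diff[OF subspace_solution_space[OF S]]
          walk_flow_cycle_in_solution_space[OF S subH, folded H_def] p p' by blast
      \<comment> \<open>Both cycles traverse \<open>a\<close> forward exactly once and otherwise
        stay in \<open>T\<close>.\<close>
      show "(walk_flow p - walk_flow p') e = 0" if "e \<notin> T" for e
        using that q q' by (cases "e = a") (auto simp: walk_flow_eq simp del: distinct.simps)
    qed
    then have eq: "walk_flow p e = walk_flow p' e" for e
      by (metis eq_iff_diff_eq_0)
    \<comment> \<open>The values 1 and -1 recover the flag, as no arc occurs with both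
      flags.\<close>
    have mem: "(e, b) \<in> set r \<longleftrightarrow> walk_flow r e = (if b then 1 else - 1)"
      if "distinct (map fst r)" for e b and r :: "(('a \<times> 'a) \<times> bool) list"
      using that eq_key_imp_eq_value[OF that, of e] by (auto simp: walk_flow_eq)
    have "set p = set p'"
      using mem[OF q(4)] mem[OF q'(4)] eq by auto
    moreover have "(a, True) \<notin> set q" "(a, True) \<notin> set q'"
      using q(1,4) q'(1,4) by force+
    ultimately have "set q = set q'" by (metis insert_ident list.set(2) q(1) q'(1))
    then show ?thesis
      using apath_eq_if_set_eq[OF wfH q(2) q'(2)] q(1) q'(1) by simp
  qed
  then show ?thesis using ex unfolding H_def by (metis list.sel(1))
qed

text \<open>The vector is the flow of the fundamental cycle, whose only arc outside \<open>T\<close>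
  is \<open>a\<close>; hence it restricts to a unit vector there.\<close>

lemma char_vector_props:
  assumes S: "pair_fin_digraph S" and T: "spanning_tree_arcs S T" and a: "a \<in> parcs S - T"
  shows "char_vector S T a \<in> solution_space S"
    and "b \<notin> T \<Longrightarrow> char_vector S T a b = of_bool (a = b)"
proof -
  interpret pair_fin_digraph S by fact
  have wf: "pair_wf_digraph S" by unfold_locales
  define H where "H = S\<lparr>parcs := T \<union> {a}\<rparr>"
  have parcs_H: "parcs H = T \<union> {a}" by (simp add: H_def)
  let ?p = "fundamental_cycle S T a"
  have subH: "T \<union> {a} \<subseteq> parcs S" using T a by (auto simp: spanning_tree_arcs_def)
  have wfH: "wf_digraph (unoriented H)"
    unfolding H_def using subH by (intro wf_digraph_unoriented pair_wf_digraph_sub[OF wf])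
  have p: "unoriented_cycle H ?p" "hd ?p = (a, True)"
    using theI'[OF ex1_fundamental_cycle[OF assms]] by (simp_all add: fundamental_cycle_def H_def)
  then obtain q where q: "?p = (a, True) # q" "set ?p \<subseteq> (T \<union> {a}) \<times> UNIV" "distinct (map fst ?p)"
    by (metis unoriented_cycle_ConsE[OF wfH] parcs_H)
  \<comment> \<open>This makes the separate case \<open>e = a\<close> of \<open>char_vector\<close>
    agree with the membership test.\<close>
  have "(a, True) \<in> set ?p" using q(1) by simp
  then have "char_vector S T a = walk_flow ?p"
    by (intro ext) (simp add: char_vector_def walk_flow_eq[OF q(3)])
  then show "char_vector S T a \<in> solution_space S"
    using walk_flow_cycle_in_solution_space[OF S subH p(1)[unfolded H_def]] by simp
  show "char_vector S T a b = of_bool (a = b)" if "b \<notin> T"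
    using that q(2) by (auto simp: char_vector_def)
qed

section \<open>Independence and span of the characteristic vectors\<close>

lemma sum_fun_apply: "(\<Sum>x\<in>A. f x) e = (\<Sum>x\<in>A. f x e)"
  for f :: "'b \<Rightarrow> 'c \<Rightarrow> 'd :: comm_monoid_add"
  by (induction A rule: infinite_finite_induct) auto

theorem lemma2:
  fixes S :: "'a pair_pre_digraph" and T :: "('a \<times> 'a) set"
  assumes "pair_digraph S"
    and "Digraph_Component.connected (with_proj S)"
    and "spanning_tree_arcs S T"
  shows "basis_of {char_vector S T a | a. a \<in> parcs S - T} (solution_space S)"
proof -
  interpret pair_digraph S by fact
  have S: "pair_fin_digraph S" by unfold_locales
  note char = char_vector_props[OF S assms(3)]
  have sub: "T \<subseteq> parcs S" and acyclic: "\<not> (\<exists>p. unoriented_cycle (S\<lparr>parcs := T\<rparr>) p)"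
    using assms(3) by (auto simp: spanning_tree_arcs_def unoriented_tree_def)
  let ?N = "parcs S - T" and ?\<delta> = "char_vector S T"
  have B: "{?\<delta> a | a. a \<in> ?N} = ?\<delta> ` ?N" by auto
  have fin: "finite ?N" using pair_finite_arcs by auto
  \<comment> \<open>Distinct arcs give vectors differing at a coordinate outside \<open>T\<close>,
    so sums over the set of vectors can be indexed by arcs.\<close>
  have inj: "inj_on ?\<delta> ?N"
    by (rule inj_onI) (metis (full_types) char(2) DiffD2 of_bool_eq_iff)
  \<comment> \<open>The coordinate at a non-tree arc reads off its coefficient; this serves both
    independence and span.\<close>
  have comb: "(\<Sum>a\<in>?N. c a * ?\<delta> a b) = c b" if "b \<in> ?N" for c b
    using fin that by (simp add: char(2) of_bool_def if_distrib cong: if_cong)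
  have "pair_fun.independent (?\<delta> ` ?N)"
  proof (rule pair_fun.independent_if_scalars_zero)
    fix f x
    assume 0: "(\<Sum>x\<in>?\<delta> ` ?N. (\<lambda>e. f x * x e)) = 0" and "x \<in> ?\<delta> ` ?N"
    then obtain b where b: "b \<in> ?N" "x = ?\<delta> b" by auto
    have "(\<Sum>a\<in>?N. f (?\<delta> a) * ?\<delta> a b) = 0"
      using fun_cong[OF 0, of b] by (simp add: sum.reindex[OF inj] sum_fun_apply)
    then show "f x = 0" using comb[OF b(1), of "\<lambda>a. f (?\<delta> a)"] b(2) by simp
  qed (simp add: fin)
  moreover have "x \<in> pair_fun.span (?\<delta> ` ?N)" if x: "x \<in> solution_space S" for x
  proof -
    \<comment> \<open>The coefficients are the values of \<open>x\<close> at the non-tree arcs, so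
      \<open>y\<close> agrees with \<open>x\<close> outside \<open>T\<close>.\<close>
    define y where "y = (\<Sum>a\<in>?N. (\<lambda>e. x a * ?\<delta> a e))"
    have y: "y \<in> pair_fun.span (?\<delta> ` ?N)"
      unfolding y_def by (intro pair_fun.span_sum pair_fun.span_scale pair_fun.span_base imageI)
    have "y \<in> solution_space S"
      using pair_fun.span_minimal[OF _ subspace_solution_space[OF S]] char(1) y by blast
    then have "x - y \<in> solution_space S"
      by (rule pair_fun.subspace_diff[OF subspace_solution_space[OF S] x])
    moreover have "(x - y) e = 0" if "e \<notin> T" for e
    proof (cases "e \<in> parcs S")
      case True
      then show ?thesis using comb[of e x] that by (simp add: y_def sum_fun_apply)
    next
      case False
      then show ?thesis
        using \<open>x - y \<in> solution_space S\<close> unfolding solution_space_def arc_vectors_def by blast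
    qed
    ultimately have "x - y = 0" by (intro solution_on_forest_eq_0[OF S sub acyclic])
    then show ?thesis using y by simp
  qed
  then have "pair_fun.span (?\<delta> ` ?N) = solution_space S"
    using pair_fun.span_minimal[OF _ subspace_solution_space[OF S]] char(1) by blast
  ultimately show ?thesis unfolding basis_of_def B by blast
qed

end
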